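(* Let $\alpha_0,\alpha_1\in\mathbb{C}$ with $\alpha_0+\alpha_1=1$ and consider the total differential system $$\begin{aligned} dx&=(-2xp-\alpha_0)\,dt+(-2xz-2\alpha_0w)\,ds,\\ dy&=(2yp+\alpha_1)\,dt+(2yz-2\alpha_1q)\,ds,\\ dz&=\tfrac{x+y}{2}\,dt+(-xq+yw-2p)\,ds,\\ dw&=(z-2wp)\,dt+(-2xp-2\alpha_0-\alpha_1)\,ds,\\ dq&=(z+2qp)\,dt+(2yp+\alpha_0+2\alpha_1)\,ds,\\ dp&=\tfrac{w+q}{2}\,dt+\tfrac{x+y}{2}\,ds, \end{aligned}$$ restricted to the common level set of its two first integrals $$w-q+2p^2+3s=C_1,\qquad 8sp^2+4zp-2wq+x-y+4sw-4sq+t+6s^2=C_2\qquad(C_1,C_2\in\mathbb{C}).$$ Then the transformations $$q_1=p,\quad p_1=x,\quad q_2=z-2wp,\quad p_2=w$$ take this system to the polynomial Hamiltonian system $$dq_i=\frac{\partial H_1}{\partial p_i}dt+\frac{\partial H_2}{\partial p_i}ds,\qquad dp_i=-\frac{\partial H_1}{\partial q_i}dt-\frac{\partial H_2}{\partial q_i}ds\qquad(i=1,2)$$ with polynomial Hamiltonians $$\begin{aligned} H_1={}&q_1^2p_1+\tfrac32sp_1-\tfrac{C_1}{2}p_1+\alpha_0q_1-p_2^3+(C_1-3s)p_2^2+\Big(-3s^2+2C_1s+\tfrac t2-\tfrac{C_2}{2}\Big)p_2-\tfrac{q_2^2}{2}+p_1p_2,\\ H_2={}&\tfrac{p_1^2}{2}-\tfrac12(C_2-4C_1s+6s^2-t)p_1+(2\alpha_0+\alpha_1)q_2-p_1p_2^2+2q_1^2p_1p_2+2q_1p_1q_2+2\alpha_0q_1p_2+(C_1-3s)p_1p_2.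 \end{aligned}$$
   Context: On the level set, the remaining variables are recovered from $q_1,p_1,q_2,p_2$ by $x=p_1$, $y=4q_1^2p_2-2p_2^2+4q_1q_2+2C_1p_2-6sp_2+p_1-6s^2+t+4C_1s-C_2$, $z=q_2+2q_1p_2$, $w=p_2$, $q=2q_1^2+p_2+3s-C_1$, $p=q_1$. *)

theory Defs
  imports "HOL-Analysis.Analysis"
begin

type_synonym times = "complex \<times> complex"
type_synonym state6 = "complex \<times> complex \<times> complex \<times> complex \<times> complex \<times> complex"
type_synonym state4 = "complex \<times> complex \<times> complex \<times> complex"

text \<open>
  A point of \<^typ>\<open>times\<close> is \<open>(t, s)\<close>, one of \<^typ>\<open>state6\<close> is \<open>(x, y, z, w, q, p)\<close> and one of
  \<^typ>\<open>state4\<close> is \<open>(q1, p1, q2, p2)\<close>.  An identity \<open>du = A dt + B ds\<close> along a solution \<open>u\<close> says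
  that the Frechet derivative of \<open>u\<close> is \<open>(dt, ds) \<mapsto> A dt + B ds\<close>.  This map is complex linear, so
  on an open set the solutions are holomorphic functions of \<open>(t, s)\<close>.
\<close>

definition solves_system :: "complex \<Rightarrow> complex \<Rightarrow> times set \<Rightarrow> (times \<Rightarrow> state6) \<Rightarrow> bool" where
  "solves_system \<alpha>\<^sub>0 \<alpha>\<^sub>1 U u \<longleftrightarrow>
    (\<forall>\<tau>\<in>U. case u \<tau> of (x, y, z, w, q, p) \<Rightarrow>
      (u has_derivative (\<lambda>(dt, ds).
        ((- 2 * x * p - \<alpha>\<^sub>0) * dt + (- 2 * x * z - 2 * \<alpha>\<^sub>0 * w) * ds,
         (2 * y * p + \<alpha>\<^sub>1) * dt + (2 * y * z - 2 * \<alpha>\<^sub>1 * q) * ds,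
         ((x + y) / 2) * dt + (- x * q + y * w - 2 * p) * ds,
         (z - 2 * w * p) * dt + (- 2 * x * p - 2 * \<alpha>\<^sub>0 - \<alpha>\<^sub>1) * ds,
         (z + 2 * q * p) * dt + (2 * y * p + \<alpha>\<^sub>0 + 2 * \<alpha>\<^sub>1) * ds,
         ((w + q) / 2) * dt + ((x + y) / 2) * ds))) (at \<tau>))"

fun first_integral1 :: "times \<Rightarrow> state6 \<Rightarrow> complex" where
  "first_integral1 (t, s) (x, y, z, w, q, p) = w - q + 2 * p\<^sup>2 + 3 * s"

fun first_integral2 :: "times \<Rightarrow> state6 \<Rightarrow> complex" where
  "first_integral2 (t, s) (x, y, z, w, q, p) =
    8 * s * p\<^sup>2 + 4 * z * p - 2 * w * q + x - y + 4 * s * w - 4 * s * q + t + 6 * s\<^sup>2"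

definition level_set :: "complex \<Rightarrow> complex \<Rightarrow> times \<Rightarrow> state6 set" where
  "level_set C\<^sub>1 C\<^sub>2 \<tau> = {v. first_integral1 \<tau> v = C\<^sub>1 \<and> first_integral2 \<tau> v = C\<^sub>2}"

fun transformation :: "state6 \<Rightarrow> state4" where
  "transformation (x, y, z, w, q, p) = (p, x, z - 2 * w * p, w)"

fun recover :: "complex \<Rightarrow> complex \<Rightarrow> times \<Rightarrow> state4 \<Rightarrow> state6" where
  "recover C\<^sub>1 C\<^sub>2 (t, s) (q1, p1, q2, p2) =
    (p1,
     4 * q1\<^sup>2 * p2 - 2 * p2\<^sup>2 + 4 * q1 * q2 + 2 * C\<^sub>1 * p2 - 6 * s * p2 + p1 - 6 * s\<^sup>2 + t
       + 4 * C\<^sub>1 * s - C\<^sub>2,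
     q2 + 2 * q1 * p2,
     p2,
     2 * q1\<^sup>2 + p2 + 3 * s - C\<^sub>1,
     q1)"

definition solves_hamiltonian_system ::
    "(times \<Rightarrow> state4 \<Rightarrow> complex) \<Rightarrow> (times \<Rightarrow> state4 \<Rightarrow> complex) \<Rightarrow> times set \<Rightarrow> (times \<Rightarrow> state4) \<Rightarrow> bool" where
  "solves_hamiltonian_system H1 H2 U u \<longleftrightarrow>
    (\<forall>\<tau>\<in>U. case u \<tau> of (q1, p1, q2, p2) \<Rightarrow>
      (u has_derivative (\<lambda>(dt, ds).
        (deriv (\<lambda>v. H1 \<tau> (q1, v, q2, p2)) p1 * dt + deriv (\<lambda>v. H2 \<tau> (q1, v, q2, p2)) p1 * ds,
         - deriv (\<lambda>v. H1 \<tau> (v, p1, q2, p2)) q1 * dt - deriv (\<lambda>v. H2 \<tau> (v, p1, q2, p2)) q1 * ds,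
         deriv (\<lambda>v. H1 \<tau> (q1, p1, q2, v)) p2 * dt + deriv (\<lambda>v. H2 \<tau> (q1, p1, q2, v)) p2 * ds,
         - deriv (\<lambda>v. H1 \<tau> (q1, p1, v, p2)) q2 * dt - deriv (\<lambda>v. H2 \<tau> (q1, p1, v, p2)) q2 * ds)))
      (at \<tau>))"

fun hamiltonian1 :: "complex \<Rightarrow> complex \<Rightarrow> complex \<Rightarrow> times \<Rightarrow> state4 \<Rightarrow> complex" where
  "hamiltonian1 \<alpha>\<^sub>0 C\<^sub>1 C\<^sub>2 (t, s) (q1, p1, q2, p2) =
    q1\<^sup>2 * p1 + 3 / 2 * s * p1 - C\<^sub>1 / 2 * p1 + \<alpha>\<^sub>0 * q1 - p2 ^ 3 + (C\<^sub>1 - 3 * s) * p2\<^sup>2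
      + (- 3 * s\<^sup>2 + 2 * C\<^sub>1 * s + t / 2 - C\<^sub>2 / 2) * p2 - q2\<^sup>2 / 2 + p1 * p2"

fun hamiltonian2 :: "complex \<Rightarrow> complex \<Rightarrow> complex \<Rightarrow> complex \<Rightarrow> times \<Rightarrow> state4 \<Rightarrow> complex" where
  "hamiltonian2 \<alpha>\<^sub>0 \<alpha>\<^sub>1 C\<^sub>1 C\<^sub>2 (t, s) (q1, p1, q2, p2) =
    p1\<^sup>2 / 2 - 1 / 2 * (C\<^sub>2 - 4 * C\<^sub>1 * s + 6 * s\<^sup>2 - t) * p1 + (2 * \<alpha>\<^sub>0 + \<alpha>\<^sub>1) * q2 - p1 * p2\<^sup>2
      + 2 * q1\<^sup>2 * p1 * p2 + 2 * q1 * p1 * q2 + 2 * \<alpha>\<^sub>0 * q1 * p2 + (C\<^sub>1 - 3 * s) * p1 * p2"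

end

theory Submission
  imports Defs
begin

text \<open>
  Both systems are compared through the partial derivatives of the individual components. That the
  transformed functions satisfy the Hamiltonian system is the chain rule, with \<open>C\<^sub>1\<close> and \<open>C\<^sub>2\<close> replaced
  by the first integrals. Conversely, the level set is the graph of \<^const>\<open>recover\<close>, so y, z and q
  are polynomials in t, s and the four canonical variables, and differentiating these
  polynomials gives the remaining equations.
\<close>

text \<open>One scalar line of a total differential system: the numbers \<open>a\<close> and
  \<open>b\<close> are the coefficients of dt and ds at \<open>\<tau>\<close>. As separate arguments
  they can be found by unification and compared one at a time.\<close>

definition has_differential ::
    "(times \<Rightarrow> complex) \<Rightarrow> complex \<Rightarrow> complex \<Rightarrow> times \<Rightarrow> bool" where
  "has_differential f a b \<tau> \<longleftrightarrow> (f has_derivative (\<lambda>(dt, ds). a * dt + b * ds)) (at \<tau>)"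

text \<open>Leaves the coefficients open, so that the calculus rules can instantiate
  \<open>a\<close> and \<open>b\<close>; what remains are the two algebraic identities
  \<open>a = a'\<close> and \<open>b = b'\<close>.\<close>

lemma has_differential_eq_rhs:
  "has_differential f a b \<tau> \<Longrightarrow> a = a' \<Longrightarrow> b = b' \<Longrightarrow> has_differential f a' b' \<tau>"
  by simp

lemma has_differential_const: "has_differential (\<lambda>_. c) 0 0 \<tau>"
  by (simp add: has_differential_def case_prod_unfold)

lemma has_differential_fst: "has_differential fst 1 0 \<tau>"
  unfolding has_differential_def case_prod_unfold
  by (auto intro!: derivative_eq_intros)

lemma has_differential_snd: "has_differential snd 0 1 \<tau>"
  unfolding has_differential_def case_prod_unfold
  by (auto intro!: derivative_eq_intros)

lemma has_differential_add:
  assumes "has_differential f a b \<tau>" and "has_differential g c d \<tau>"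
  shows "has_differential (\<lambda>\<tau>. f \<tau> + g \<tau>) (a + c) (b + d) \<tau>"
  using has_derivative_add[OF assms[unfolded has_differential_def]]
  by (simp add: has_differential_def case_prod_unfold algebra_simps)

lemma has_differential_diff:
  assumes "has_differential f a b \<tau>" and "has_differential g c d \<tau>"
  shows "has_differential (\<lambda>\<tau>. f \<tau> - g \<tau>) (a - c) (b - d) \<tau>"
  using has_derivative_diff[OF assms[unfolded has_differential_def]]
  by (simp add: has_differential_def case_prod_unfold algebra_simps)

lemma has_differential_mult:
  assumes "has_differential f a b \<tau>" and "has_differential g c d \<tau>"
  shows "has_differential (\<lambda>\<tau>. f \<tau> * g \<tau>)
    (f \<tau> * c + a * g \<tau>) (f \<tau> * d + b * g \<tau>) \<tau>"
  using has_derivative_mult[OF assms[unfolded has_differential_def]]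
  by (simp add: has_differential_def case_prod_unfold algebra_simps)

lemma has_differential_power2:
  assumes "has_differential f a b \<tau>"
  shows "has_differential (\<lambda>\<tau>. (f \<tau>)\<^sup>2) (2 * f \<tau> * a) (2 * f \<tau> * b) \<tau>"
  unfolding power2_eq_square
  by (rule has_differential_eq_rhs[OF has_differential_mult[OF assms assms]]) simp_all

lemmas has_differential_intros =
  has_differential_const has_differential_fst has_differential_snd has_differential_add
  has_differential_diff has_differential_mult has_differential_power2

text \<open>A derivative depends only on nearby values. This carries a differential computed for a
  polynomial in the canonical variables over to \<open>z\<close>, \<open>q\<close> and
  \<open>y\<close>, whose agreement with it is known on \<open>U\<close>.\<close>

lemma has_differential_cong_open:
  assumes "has_differential f a b \<tau>" and "open U" and "\<tau> \<in> U" and "\<And>\<sigma>. \<sigma> \<in> U \<Longrightarrow> f \<sigma> = g \<sigma>"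
  shows "has_differential g a b \<tau>"
  using assms has_derivative_transform_within_open unfolding has_differential_def by blast

lemma has_differential_zero_constant_on:
  assumes "open U" and "connected U" and "\<And>\<tau>. \<tau> \<in> U \<Longrightarrow> has_differential f 0 0 \<tau>"
  shows "f constant_on U"
proof (rule has_derivative_zero_connected_constant_on[where K = "{}"])
  show "continuous_on U f"
    using assms(3) unfolding has_differential_def
    by (intro continuous_at_imp_continuous_on ballI) (rule has_derivative_continuous)
  show "\<forall>\<tau>\<in>U - {}. (f has_derivative (\<lambda>h. 0)) (at \<tau> within U)"
    using assms(3) unfolding has_differential_def
    by (simp add: case_prod_unfold has_derivative_at_withinI)
qed (use assms in auto)

text \<open>The projections are bounded linear, which gives the forward direction. As an equivalence
  it rewrites a differential of nested tuples into scalar statements.\<close>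

lemma has_derivative_Pair_iff:
  "((\<lambda>x. (f x, g x)) has_derivative (\<lambda>h. (f' h, g' h))) (at x within S) \<longleftrightarrow>
    (f has_derivative f') (at x within S) \<and> (g has_derivative g') (at x within S)"
  using has_derivative_fst[of "\<lambda>x. (f x, g x)" "\<lambda>h. (f' h, g' h)" "at x within S"]
    has_derivative_snd[of "\<lambda>x. (f x, g x)" "\<lambda>h. (f' h, g' h)" "at x within S"]
  by (auto intro: has_derivative_Pair)

text \<open>Brings an arbitrary \<open>u\<close> into the literal tuple shape on which
  \<open>solves_system_iff\<close> rewrites.\<close>

lemma state6_components:
  fixes u :: "times \<Rightarrow> state6"
  obtains x y z w q p where "u = (\<lambda>\<tau>. (x \<tau>, y \<tau>, z \<tau>, w \<tau>, q \<tau>, p \<tau>))"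
proof
  show "u = (\<lambda>\<tau>. (fst (u \<tau>), fst (snd (u \<tau>)), fst (snd (snd (u \<tau>))),
    fst (snd (snd (snd (u \<tau>)))), fst (snd (snd (snd (snd (u \<tau>))))),
    snd (snd (snd (snd (snd (u \<tau>)))))))"
    by simp
qed

lemma solves_system_iff:
  "solves_system \<alpha>\<^sub>0 \<alpha>\<^sub>1 U (\<lambda>\<tau>. (x \<tau>, y \<tau>, z \<tau>, w \<tau>, q \<tau>, p \<tau>)) \<longleftrightarrow>
    (\<forall>\<tau>\<in>U.
      has_differential x (- 2 * x \<tau> * p \<tau> - \<alpha>\<^sub>0) (- 2 * x \<tau> * z \<tau> - 2 * \<alpha>\<^sub>0 * w \<tau>) \<tau> \<and>
      has_differential y (2 * y \<tau> * p \<tau> + \<alpha>\<^sub>1) (2 * y \<tau> * z \<tau> - 2 * \<alpha>\<^sub>1 * q \<tau>) \<tau> \<and>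
      has_differential z ((x \<tau> + y \<tau>) / 2) (- x \<tau> * q \<tau> + y \<tau> * w \<tau> - 2 * p \<tau>) \<tau> \<and>
      has_differential w (z \<tau> - 2 * w \<tau> * p \<tau>) (- 2 * x \<tau> * p \<tau> - 2 * \<alpha>\<^sub>0 - \<alpha>\<^sub>1) \<tau> \<and>
      has_differential q (z \<tau> + 2 * q \<tau> * p \<tau>) (2 * y \<tau> * p \<tau> + \<alpha>\<^sub>0 + 2 * \<alpha>\<^sub>1) \<tau> \<and>
      has_differential p ((w \<tau> + q \<tau>) / 2) ((x \<tau> + y \<tau>) / 2) \<tau>)"
  unfolding solves_system_def has_differential_def
  by (simp add: case_prod_unfold has_derivative_Pair_iff)

lemma deriv_hamiltonian1:
  "deriv (\<lambda>v. hamiltonian1 \<alpha>\<^sub>0 C\<^sub>1 C\<^sub>2 \<tau> (v, p1, q2, p2)) q1 = 2 * q1 * p1 + \<alpha>\<^sub>0"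
  "deriv (\<lambda>v. hamiltonian1 \<alpha>\<^sub>0 C\<^sub>1 C\<^sub>2 \<tau> (q1, v, q2, p2)) p1 =
    q1\<^sup>2 + 3 / 2 * snd \<tau> - C\<^sub>1 / 2 + p2"
  "deriv (\<lambda>v. hamiltonian1 \<alpha>\<^sub>0 C\<^sub>1 C\<^sub>2 \<tau> (q1, p1, v, p2)) q2 = - q2"
  "deriv (\<lambda>v. hamiltonian1 \<alpha>\<^sub>0 C\<^sub>1 C\<^sub>2 \<tau> (q1, p1, q2, v)) p2 =
    - 3 * p2\<^sup>2 + 2 * (C\<^sub>1 - 3 * snd \<tau>) * p2
      + (- 3 * (snd \<tau>)\<^sup>2 + 2 * C\<^sub>1 * snd \<tau> + fst \<tau> / 2 - C\<^sub>2 / 2) + p1"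
  \<comment> \<open>Splitting \<open>\<tau>\<close> exposes the pattern \<open>(t, s)\<close> in the
    defining equation, so the function under \<open>deriv\<close> becomes an explicit polynomial in
    one variable.\<close>
  by (cases \<tau>; rule DERIV_imp_deriv;
      auto intro!: derivative_eq_intros simp: power2_eq_square algebra_simps)+

lemma deriv_hamiltonian2:
  "deriv (\<lambda>v. hamiltonian2 \<alpha>\<^sub>0 \<alpha>\<^sub>1 C\<^sub>1 C\<^sub>2 \<tau> (v, p1, q2, p2)) q1 =
    4 * q1 * p1 * p2 + 2 * p1 * q2 + 2 * \<alpha>\<^sub>0 * p2"
  "deriv (\<lambda>v. hamiltonian2 \<alpha>\<^sub>0 \<alpha>\<^sub>1 C\<^sub>1 C\<^sub>2 \<tau> (q1, v, q2, p2)) p1 =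
    p1 - 1 / 2 * (C\<^sub>2 - 4 * C\<^sub>1 * snd \<tau> + 6 * (snd \<tau>)\<^sup>2 - fst \<tau>) - p2\<^sup>2 + 2 * q1\<^sup>2 * p2 + 2 * q1 * q2
      + (C\<^sub>1 - 3 * snd \<tau>) * p2"
  "deriv (\<lambda>v. hamiltonian2 \<alpha>\<^sub>0 \<alpha>\<^sub>1 C\<^sub>1 C\<^sub>2 \<tau> (q1, p1, v, p2)) q2 =
    2 * \<alpha>\<^sub>0 + \<alpha>\<^sub>1 + 2 * q1 * p1"
  "deriv (\<lambda>v. hamiltonian2 \<alpha>\<^sub>0 \<alpha>\<^sub>1 C\<^sub>1 C\<^sub>2 \<tau> (q1, p1, q2, v)) p2 =
    - 2 * p1 * p2 + 2 * q1\<^sup>2 * p1 + 2 * \<alpha>\<^sub>0 * q1 + (C\<^sub>1 - 3 * snd \<tau>) * p1"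
  by (cases \<tau>; rule DERIV_imp_deriv;
      auto intro!: derivative_eq_intros simp: power2_eq_square algebra_simps)+

lemma solves_hamiltonian_system_iff:
  "solves_hamiltonian_system (hamiltonian1 \<alpha>\<^sub>0 C\<^sub>1 C\<^sub>2) (hamiltonian2 \<alpha>\<^sub>0 \<alpha>\<^sub>1 C\<^sub>1 C\<^sub>2) U
      (\<lambda>\<tau>. (q1 \<tau>, p1 \<tau>, q2 \<tau>, p2 \<tau>)) \<longleftrightarrow>
    (\<forall>\<tau>\<in>U.
      has_differential q1 ((q1 \<tau>)\<^sup>2 + 3 / 2 * snd \<tau> - C\<^sub>1 / 2 + p2 \<tau>)
        (p1 \<tau> - 1 / 2 * (C\<^sub>2 - 4 * C\<^sub>1 * snd \<tau> + 6 * (snd \<tau>)\<^sup>2 - fst \<tau>) - (p2 \<tau>)\<^sup>2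
          + 2 * (q1 \<tau>)\<^sup>2 * p2 \<tau> + 2 * q1 \<tau> * q2 \<tau> + (C\<^sub>1 - 3 * snd \<tau>) * p2 \<tau>) \<tau> \<and>
      has_differential p1 (- (2 * q1 \<tau> * p1 \<tau> + \<alpha>\<^sub>0))
        (- (4 * q1 \<tau> * p1 \<tau> * p2 \<tau> + 2 * p1 \<tau> * q2 \<tau> + 2 * \<alpha>\<^sub>0 * p2 \<tau>)) \<tau> \<and>
      has_differential q2
        (- 3 * (p2 \<tau>)\<^sup>2 + 2 * (C\<^sub>1 - 3 * snd \<tau>) * p2 \<tau>
          + (- 3 * (snd \<tau>)\<^sup>2 + 2 * C\<^sub>1 * snd \<tau> + fst \<tau> / 2 - C\<^sub>2 / 2) + p1 \<tau>)
        (- 2 * p1 \<tau> * p2 \<tau> + 2 * (q1 \<tau>)\<^sup>2 * p1 \<tau> + 2 * \<alpha>\<^sub>0 * q1 \<tau>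
          + (C\<^sub>1 - 3 * snd \<tau>) * p1 \<tau>) \<tau> \<and>
      has_differential p2 (q2 \<tau>) (- (2 * \<alpha>\<^sub>0 + \<alpha>\<^sub>1 + 2 * q1 \<tau> * p1 \<tau>)) \<tau>)"
  unfolding solves_hamiltonian_system_def has_differential_def prod.case
    deriv_hamiltonian1 deriv_hamiltonian2 case_prod_unfold has_derivative_Pair_iff
  by (simp add: algebra_simps)

text \<open>Both differentials vanish: the parameter-free terms of degree two or more in the
  unknowns cancel, and the explicit dependence on t and s is balanced by
  \<open>\<alpha>\<^sub>0 + \<alpha>\<^sub>1 = 1\<close>. For instance, the ds coefficient of the
  first is \<open>3 - 3 * (\<alpha>\<^sub>0 + \<alpha>\<^sub>1)\<close> and the dt coefficient of
  the second is \<open>1 - (\<alpha>\<^sub>0 + \<alpha>\<^sub>1)\<close>.\<close>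

lemma first_integrals_constant_on:
  fixes u :: "times \<Rightarrow> state6"
  assumes "\<alpha>\<^sub>0 + \<alpha>\<^sub>1 = 1" and "open U" and "connected U" and "solves_system \<alpha>\<^sub>0 \<alpha>\<^sub>1 U u"
  shows "(\<lambda>\<tau>. first_integral1 \<tau> (u \<tau>)) constant_on U"
    and "(\<lambda>\<tau>. first_integral2 \<tau> (u \<tau>)) constant_on U"
proof -
  obtain x y z w q p where u: "u = (\<lambda>\<tau>. (x \<tau>, y \<tau>, z \<tau>, w \<tau>, q \<tau>, p \<tau>))"
    by (rule state6_components)
  note d = assms(4)[unfolded u solves_system_iff, rule_format]
  have \<alpha>\<^sub>1: "\<alpha>\<^sub>1 = 1 - \<alpha>\<^sub>0"
    using assms(1) by (simp add: algebra_simps)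
  have 1: "(\<lambda>\<tau>. first_integral1 \<tau> (u \<tau>)) = (\<lambda>\<tau>. w \<tau> - q \<tau> + 2 * (p \<tau>)\<^sup>2 + 3 * snd \<tau>)"
    by (auto simp: u fun_eq_iff)
  have 2: "(\<lambda>\<tau>. first_integral2 \<tau> (u \<tau>)) = (\<lambda>\<tau>. 8 * snd \<tau> * (p \<tau>)\<^sup>2 + 4 * z \<tau> * p \<tau>
    - 2 * w \<tau> * q \<tau> + x \<tau> - y \<tau> + 4 * snd \<tau> * w \<tau> - 4 * snd \<tau> * q \<tau> + fst \<tau> + 6 * (snd \<tau>)\<^sup>2)"
    by (auto simp: u fun_eq_iff)
  show "(\<lambda>\<tau>. first_integral1 \<tau> (u \<tau>)) constant_on U"
    unfolding 1
  proof (rule has_differential_zero_constant_on[OF assms(2,3)])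
    fix \<tau> assume "\<tau> \<in> U"
    from d[OF this]
    show "has_differential (\<lambda>\<tau>. w \<tau> - q \<tau> + 2 * (p \<tau>)\<^sup>2 + 3 * snd \<tau>) 0 0 \<tau>"
      \<comment> \<open>The differentials of the unknowns are taken from the system by assumption,
        those of compound terms from the calculus rules; the last two goals are polynomial
        identities modulo \<open>\<alpha>\<^sub>1 = 1 - \<alpha>\<^sub>0\<close>.\<close>
      by (elim conjE)
         (rule has_differential_eq_rhs, (assumption | rule has_differential_intros)+,
          simp_all (no_asm) add: \<alpha>\<^sub>1 field_simps power2_eq_square)
  qed
  show "(\<lambda>\<tau>. first_integral2 \<tau> (u \<tau>)) constant_on U"
    unfolding 2
  proof (rule has_differential_zero_constant_on[OF assms(2,3)])
    fix \<tau> assume "\<tau> \<in> U"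
    from d[OF this]
    show "has_differential (\<lambda>\<tau>. 8 * snd \<tau> * (p \<tau>)\<^sup>2 + 4 * z \<tau> * p \<tau> - 2 * w \<tau> * q \<tau> + x \<tau> - y \<tau>
        + 4 * snd \<tau> * w \<tau> - 4 * snd \<tau> * q \<tau> + fst \<tau> + 6 * (snd \<tau>)\<^sup>2) 0 0 \<tau>"
      by (elim conjE)
         (rule has_differential_eq_rhs, (assumption | rule has_differential_intros)+,
          simp_all (no_asm) add: \<alpha>\<^sub>1 field_simps power2_eq_square)
  qed
qed

text \<open>The first integral is linear in \<open>q\<close> and the second contains
  \<open>y\<close> only as \<open>- y\<close>, so the level equations determine \<open>q\<close> and
  then \<open>y\<close>, while \<open>z\<close> returns by adding \<open>2 * w * p\<close>. The
  proof eliminates \<open>C\<^sub>1\<close> and \<open>C\<^sub>2\<close> instead, which leaves ring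
  identities.\<close>

lemma recover_transformation:
  assumes "v \<in> level_set C\<^sub>1 C\<^sub>2 \<tau>"
  shows "recover C\<^sub>1 C\<^sub>2 \<tau> (transformation v) = v"
proof -
  obtain t s where \<tau>: "\<tau> = (t, s)" by fastforce
  obtain x y z w q p where v: "v = (x, y, z, w, q, p)" by (cases v)
  have C: "C\<^sub>1 = w - q + 2 * p\<^sup>2 + 3 * s"
    "C\<^sub>2 = 8 * s * p\<^sup>2 + 4 * z * p - 2 * w * q + x - y + 4 * s * w - 4 * s * q + t + 6 * s\<^sup>2"
    using assms by (auto simp: level_set_def \<tau> v)
  show ?thesis
    unfolding C \<tau> v by (simp add: power2_eq_square algebra_simps)
qed

lemma transformation_recover: "transformation (recover C\<^sub>1 C\<^sub>2 \<tau> v) = v"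
  by (cases \<tau>; cases v) simp

text \<open>With \<open>transformation_recover\<close> this gives surjectivity: every canonical
  point comes from a point of the level set.\<close>

lemma recover_in_level_set: "recover C\<^sub>1 C\<^sub>2 \<tau> v \<in> level_set C\<^sub>1 C\<^sub>2 \<tau>"
  by (cases \<tau>; cases v) (simp add: level_set_def power2_eq_square algebra_simps)

lemma bij_betw_transformation: "bij_betw transformation (level_set C\<^sub>1 C\<^sub>2 \<tau>) UNIV"
  by (rule bij_betw_byWitness[where f' = "recover C\<^sub>1 C\<^sub>2 \<tau>"])
     (auto simp: recover_transformation transformation_recover recover_in_level_set)

lemma solves_system_iff_hamiltonian:
  fixes u :: "times \<Rightarrow> state6"
  assumes "\<alpha>\<^sub>0 + \<alpha>\<^sub>1 = 1" and "open U" and "\<And>\<tau>. \<tau> \<in> U \<Longrightarrow> u \<tau> \<in> level_set C\<^sub>1 C\<^sub>2 \<tau>"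
  shows "solves_system \<alpha>\<^sub>0 \<alpha>\<^sub>1 U u \<longleftrightarrow>
    solves_hamiltonian_system (hamiltonian1 \<alpha>\<^sub>0 C\<^sub>1 C\<^sub>2) (hamiltonian2 \<alpha>\<^sub>0 \<alpha>\<^sub>1 C\<^sub>1 C\<^sub>2) U
      (transformation \<circ> u)"
proof -
  obtain x y z w q p where u: "u = (\<lambda>\<tau>. (x \<tau>, y \<tau>, z \<tau>, w \<tau>, q \<tau>, p \<tau>))"
    by (rule state6_components)
  have Tu: "transformation \<circ> u = (\<lambda>\<tau>. (p \<tau>, x \<tau>, z \<tau> - 2 * w \<tau> * p \<tau>, w \<tau>))"
    by (simp add: u fun_eq_iff)
  have \<alpha>\<^sub>1: "\<alpha>\<^sub>1 = 1 - \<alpha>\<^sub>0"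
    using assms(1) by (simp add: algebra_simps)
  \<comment> \<open>Naming this function makes its differential a single hypothesis when the
    Hamiltonian system is assumed.\<close>
  define q2 where "q2 = (\<lambda>\<tau>. z \<tau> - 2 * w \<tau> * p \<tau>)"
  have C: "C\<^sub>1 = w \<tau> - q \<tau> + 2 * (p \<tau>)\<^sup>2 + 3 * snd \<tau>"
    "C\<^sub>2 = 8 * snd \<tau> * (p \<tau>)\<^sup>2 + 4 * z \<tau> * p \<tau> - 2 * w \<tau> * q \<tau> + x \<tau> - y \<tau>
      + 4 * snd \<tau> * w \<tau> - 4 * snd \<tau> * q \<tau> + fst \<tau> + 6 * (snd \<tau>)\<^sup>2" if "\<tau> \<in> U" for \<tau>
    using assms(3)[OF that] by (cases \<tau>; auto simp: level_set_def u)+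
  \<comment> \<open>These hold at every point of \<open>U\<close>, not just at one point, since they
    are to be differentiated.\<close>
  have rec: "z \<tau> = q2 \<tau> + 2 * p \<tau> * w \<tau>" "q \<tau> = 2 * (p \<tau>)\<^sup>2 + w \<tau> + 3 * snd \<tau> - C\<^sub>1"
    "y \<tau> = 4 * (p \<tau>)\<^sup>2 * w \<tau> - 2 * (w \<tau>)\<^sup>2 + 4 * p \<tau> * q2 \<tau> + 2 * C\<^sub>1 * w \<tau> - 6 * snd \<tau> * w \<tau> + x \<tau>
      - 6 * (snd \<tau>)\<^sup>2 + fst \<tau> + 4 * C\<^sub>1 * snd \<tau> - C\<^sub>2" if "\<tau> \<in> U" for \<tau>
    using recover_transformation[OF assms(3)[OF that]]
    by (cases \<tau>; simp add: u q2_def)+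
  show ?thesis
    \<comment> \<open>\<open>Tu\<close> has to be applied while \<open>u\<close> is still folded,
      because its left-hand side mentions \<open>u\<close>.\<close>
    unfolding Tu unfolding u q2_def[symmetric] solves_system_iff solves_hamiltonian_system_iff
  proof (rule ball_cong[OF refl], goal_cases)
    case (1 \<tau>)
    note C = C[OF this]
    show ?case
    proof (rule iffI, goal_cases)
      case 1
      note d = this
      \<comment> \<open>The only canonical equation that needs the product rule. In its ds
        coefficient \<open>\<alpha>\<^sub>0 + \<alpha>\<^sub>1 = 1\<close> absorbs the term
        \<open>- 2 * p \<tau>\<close> coming from dz.\<close>
      have q2: "has_differential q2
        (- 3 * (w \<tau>)\<^sup>2 + 2 * (C\<^sub>1 - 3 * snd \<tau>) * w \<tau>
          + (- 3 * (snd \<tau>)\<^sup>2 + 2 * C\<^sub>1 * snd \<tau> + fst \<tau> / 2 - C\<^sub>2 / 2) + x \<tau>)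
        (- 2 * x \<tau> * w \<tau> + 2 * (p \<tau>)\<^sup>2 * x \<tau> + 2 * \<alpha>\<^sub>0 * p \<tau> + (C\<^sub>1 - 3 * snd \<tau>) * x \<tau>) \<tau>"
        using d unfolding q2_def
        by (elim conjE)
           (rule has_differential_eq_rhs, (assumption | rule has_differential_intros)+,
            simp_all (no_asm) add: C \<alpha>\<^sub>1 field_simps power2_eq_square)
      \<comment> \<open>The equations for \<open>p\<close>, \<open>x\<close> and \<open>w\<close>
        are already present; their coefficients match after substituting for \<open>q2\<close>,
        \<open>C\<^sub>1\<close> and \<open>C\<^sub>2\<close>.\<close>
      from d show ?case
        by (intro conjI q2; elim conjE)
           (erule has_differential_eq_rhs; simp (no_asm) add: q2_def C field_simps power2_eq_square)+
    next
      case 2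
      note d = this
      have z: "has_differential z ((x \<tau> + y \<tau>) / 2) (- x \<tau> * q \<tau> + y \<tau> * w \<tau> - 2 * p \<tau>) \<tau>"
      proof (rule has_differential_cong_open[OF _ \<open>open U\<close> \<open>\<tau> \<in> U\<close> rec(1)[symmetric]])
        show "has_differential (\<lambda>\<tau>. q2 \<tau> + 2 * p \<tau> * w \<tau>) ((x \<tau> + y \<tau>) / 2)
          (- x \<tau> * q \<tau> + y \<tau> * w \<tau> - 2 * p \<tau>) \<tau>"
          using d
          by (elim conjE)
             (rule has_differential_eq_rhs, (assumption | rule has_differential_intros)+,
              simp_all (no_asm) add: q2_def C \<alpha>\<^sub>1 field_simps power2_eq_square)
      qed
      \<comment> \<open>The explicit \<open>3 * snd \<tau>\<close> contributes
        \<open>3 = 3 * (\<alpha>\<^sub>0 + \<alpha>\<^sub>1)\<close>, which turns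
        \<open>- 2 * \<alpha>\<^sub>0 - \<alpha>\<^sub>1\<close> from dw into
        \<open>\<alpha>\<^sub>0 + 2 * \<alpha>\<^sub>1\<close>.\<close>
      have q: "has_differential q (z \<tau> + 2 * q \<tau> * p \<tau>) (2 * y \<tau> * p \<tau> + \<alpha>\<^sub>0 + 2 * \<alpha>\<^sub>1) \<tau>"
      proof (rule has_differential_cong_open[OF _ \<open>open U\<close> \<open>\<tau> \<in> U\<close> rec(2)[symmetric]])
        show "has_differential (\<lambda>\<tau>. 2 * (p \<tau>)\<^sup>2 + w \<tau> + 3 * snd \<tau> - C\<^sub>1)
          (z \<tau> + 2 * q \<tau> * p \<tau>) (2 * y \<tau> * p \<tau> + \<alpha>\<^sub>0 + 2 * \<alpha>\<^sub>1) \<tau>"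
          using d
          by (elim conjE)
             (rule has_differential_eq_rhs, (assumption | rule has_differential_intros)+,
              simp_all (no_asm) add: q2_def C \<alpha>\<^sub>1 field_simps power2_eq_square)
      qed
      \<comment> \<open>\<open>C\<^sub>1\<close> and \<open>C\<^sub>2\<close> are differentiated as
        constants; only in the resulting coefficient identities at \<open>\<tau>\<close> are they
        replaced by the first integrals.\<close>
      have y: "has_differential y (2 * y \<tau> * p \<tau> + \<alpha>\<^sub>1) (2 * y \<tau> * z \<tau> - 2 * \<alpha>\<^sub>1 * q \<tau>) \<tau>"
      proof (rule has_differential_cong_open[OF _ \<open>open U\<close> \<open>\<tau> \<in> U\<close> rec(3)[symmetric]])
        show "has_differential (\<lambda>\<tau>. 4 * (p \<tau>)\<^sup>2 * w \<tau> - 2 * (w \<tau>)\<^sup>2 + 4 * p \<tau> * q2 \<tau>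
            + 2 * C\<^sub>1 * w \<tau> - 6 * snd \<tau> * w \<tau> + x \<tau> - 6 * (snd \<tau>)\<^sup>2 + fst \<tau> + 4 * C\<^sub>1 * snd \<tau> - C\<^sub>2)
          (2 * y \<tau> * p \<tau> + \<alpha>\<^sub>1) (2 * y \<tau> * z \<tau> - 2 * \<alpha>\<^sub>1 * q \<tau>) \<tau>"
          using d
          by (elim conjE)
             (rule has_differential_eq_rhs, (assumption | rule has_differential_intros)+,
              simp_all (no_asm) add: q2_def C \<alpha>\<^sub>1 field_simps power2_eq_square)
      qed
      from d show ?case
        by (intro conjI y z q; elim conjE)
           (erule has_differential_eq_rhs; simp (no_asm) add: q2_def C \<alpha>\<^sub>1 field_simps power2_eq_square)+
    qed
  qed
qed

theorem theorem3p2: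
  fixes \<alpha>\<^sub>0 \<alpha>\<^sub>1 C\<^sub>1 C\<^sub>2 :: complex
  assumes "\<alpha>\<^sub>0 + \<alpha>\<^sub>1 = 1"
  shows
    "(\<forall>U u. open U \<and> connected U \<and> solves_system \<alpha>\<^sub>0 \<alpha>\<^sub>1 U u \<longrightarrow>
        (\<lambda>\<tau>. first_integral1 \<tau> (u \<tau>)) constant_on U \<and>
        (\<lambda>\<tau>. first_integral2 \<tau> (u \<tau>)) constant_on U)
   \<and> (\<forall>\<tau>. bij_betw transformation (level_set C\<^sub>1 C\<^sub>2 \<tau>) UNIV \<and>
        (\<forall>v \<in> level_set C\<^sub>1 C\<^sub>2 \<tau>. recover C\<^sub>1 C\<^sub>2 \<tau> (transformation v) = v))
   \<and> (\<forall>U u. open U \<and> (\<forall>\<tau>\<in>U. u \<tau> \<in> level_set C\<^sub>1 C\<^sub>2 \<tau>) \<longrightarrow>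
        (solves_system \<alpha>\<^sub>0 \<alpha>\<^sub>1 U u \<longleftrightarrow>
         solves_hamiltonian_system (hamiltonian1 \<alpha>\<^sub>0 C\<^sub>1 C\<^sub>2) (hamiltonian2 \<alpha>\<^sub>0 \<alpha>\<^sub>1 C\<^sub>1 C\<^sub>2) U
           (transformation \<circ> u)))"
  using assms
  by (intro conjI allI impI ballI first_integrals_constant_on bij_betw_transformation
      recover_transformation solves_system_iff_hamiltonian) auto

end
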